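(* Let $f:\mathbb{R}^n\to\mathbb{R}$ be quasi-convex, continuous and coercive, let $X\subseteq\mathbb{R}^n$ be nonempty, closed and convex, and let $f^*$ and $X^*\neq\emptyset$ be the minimum value and the set of minimizers of $f$ over $X$. Fix $\epsilon\ge0$ and $p\in(0,1]$, and let $v_k=ck^{-s}$ for $k\in\mathbb{N}$, where $c>0$ and $s\in(0,1)$. Let $\{x_k\}_{k\in\mathbb{N}}\subseteq X$, and let $\{\alpha_k\},\{\beta_k\},\{\gamma_k\}$ be sequences of positive scalars with $\lim_k\alpha_k=\alpha>0$, $\lim_k\beta_k=\beta>0$, $\lim_k\gamma_k=\gamma>0$, such that for each $x^*\in X^*$ and each $k\in\mathbb{N}$ with $f(x_k)>f^*+\epsilon$, $$\|x_{k+1}-x^*\|^2-\|x_k-x^*\|^2\le-\alpha_kv_k\,(f(x_k)-f^*-\epsilon)^{\frac1p}+\beta_kv_k^2,$$ and $\|x_{k+1}-x_k\|\le\gamma_kv_k$ for each $k\in\mathbb{N}$. Suppose that $X^*$ is the set of boundedly weak sharp minima of order $2p$ for $f$ over $X$, with modulus $\eta_r>0$ on $\mathbf{B}(0,r)$ for each $r>0$ with $X^*\cap\mathbf{B}(0,r)\ne\emptyset$. Then either $x_k\in X^*_\epsilon$ for some $k\in\mathbb{N}$, or there is $r>0$ with $X^*\cap\mathbf{B}(0,r)\neq\emptyset$ and $\{x_k\}\subseteq\mathbf{B}(0,r)$ such that, with $\eta:=\eta_r$, the following hold. (i) If $\epsilon=0$, then there exists $N\in\mathbb{N}$ such that $$\mathrm{dist}^2(x_k,X^*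 )\le\frac{\beta c}{\alpha}\left(\frac2\eta\right)^{\frac1p}k^{-s}\quad\text{for each }k\ge N.$$ (ii) If $\epsilon>0$, then there exist $C>0$ and $\tau\in(0,1)$ such that $$\mathrm{dist}^2(x_k,X^* )\le C\tau^k+\left(\frac{2\epsilon}{\eta}\right)^{\frac1p}\quad\text{for each }k\in\mathbb{N}.$$
   Context: $\mathbb{N}=\{1,2,\dots\}$; $\|\cdot\|$ is the Euclidean norm, $\mathrm{dist}(x,Z)=\min_{z\in Z}\|x-z\|$, and $\mathbf{B}(0,r)$ is the closed ball of radius $r$ centered at $0$. $f$ is quasi-convex if $f((1-a)x+ay)\le\max\{f(x),f(y)\}$ for all $x,y$ and $a\in[0,1]$; $f$ is coercive if $f(x)\to\infty$ as $\|x\|\to\infty$. $X^*_\epsilon:=\{x\in X:f(x)\le f^*+\epsilon\}$ (so $X^*_0=X^*$). For an order $q\ge 1$ and $S\subseteq\mathbb{R}^n$, $X^*$ is the set of weak sharp minima of order $q$ for $f$ on $S$ over $X$ with modulus $\eta>0$ if $f(y)-f^*\ge\eta\,\mathrm{dist}^q(y,X^* )$ for each $y\in S\cap X$. $X^*$ is the set of boundedly weak sharp minima of order $q$ for $f$ over $X$ if for each $r>0$ with $X^*\cap\mathbf{B}(0,r)\neq\emptyset$ there is $\eta_r>0$ such that $X^*$ is the set of weak sharp minima of order $q$ for $f$ on $\mathbf{B}(0,r)$ over $X$ with modulus $\eta_r$. Here $q=2p$ (and orders are always $\ge1$). *)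

theory Defs
  imports "HOL-Analysis.Analysis"
begin

definition quasi_convex :: "('a::real_vector \<Rightarrow> real) \<Rightarrow> bool" where
  "quasi_convex f \<longleftrightarrow>
     (\<forall>x y. \<forall>a\<in>{0..1}. f ((1 - a) *\<^sub>R x + a *\<^sub>R y) \<le> max (f x) (f y))"

(* An infimum, hence only the minimum value when the minimum is attained; see opt_value_eq. *)
definition opt_value :: "('a \<Rightarrow> real) \<Rightarrow> 'a set \<Rightarrow> real" where
  "opt_value f X = (INF x\<in>X. f x)"

definition minimizers :: "('a \<Rightarrow> real) \<Rightarrow> 'a set \<Rightarrow> 'a set" where
  "minimizers f X = {x. is_arg_min f (\<lambda>y. y \<in> X) x}"

definition eps_minimizers :: "('a \<Rightarrow> real) \<Rightarrow> 'a set \<Rightarrow> real \<Rightarrow> 'a set" where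
  "eps_minimizers f X \<epsilon> = {x \<in> X. f x \<le> opt_value f X + \<epsilon>}"

(* The distance to the set of minimizers is infdist. For continuous f, closed X and a nonempty
   set of minimizers the infimum is attained, so it is the minimal distance; for an empty set of
   minimizers infdist would be 0. *)
definition weak_sharp_minima ::
  "('a::metric_space \<Rightarrow> real) \<Rightarrow> 'a set \<Rightarrow> 'a set \<Rightarrow> real \<Rightarrow> real \<Rightarrow> bool" where
  "weak_sharp_minima f S X q \<eta> \<longleftrightarrow>
     q \<ge> 1 \<and> \<eta> > 0 \<and>
     (\<forall>y\<in>S \<inter> X. f y - opt_value f X \<ge> \<eta> * infdist y (minimizers f X) powr q)"

definition boundedly_weak_sharp_minima ::
  "('a::real_normed_vector \<Rightarrow> real) \<Rightarrow> 'a set \<Rightarrow> real \<Rightarrow> bool" where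
  "boundedly_weak_sharp_minima f X q \<longleftrightarrow>
     (\<forall>r>0. minimizers f X \<inter> cball 0 r \<noteq> {} \<longrightarrow>
        (\<exists>\<eta>>0. weak_sharp_minima f (cball 0 r) X q \<eta>))"

lemma opt_value_eq:
  assumes "x \<in> minimizers f X"
  shows "opt_value f X = f x"
  unfolding opt_value_def
  using assms
  by (intro cInf_eq_minimum) (auto simp: minimizers_def is_arg_min_def not_less)

lemma eps_minimizers_0:
  assumes "minimizers f X \<noteq> {}"
  shows "eps_minimizers f X 0 = minimizers f X"
proof -
  obtain z where z: "z \<in> minimizers f X"
    using assms by auto
  then show ?thesis
    unfolding eps_minimizers_def opt_value_eq[OF z]
    by (fastforce simp: minimizers_def is_arg_min_def not_less)
qed

end

theory Submission
  imports Defs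
begin

text \<open>
  Suppose no iterate is an \<open>\<epsilon>\<close>-minimizer, so that the basic inequality holds at every step. All
  three claims then come from one trapping principle: a sequence that drops by at least a fixed
  multiple of \<open>v\<^sub>k\<close> whenever it exceeds a level \<open>L\<close>, and never grows by more than a multiple of
  \<open>v\<^sub>k\<close>, is eventually below any level above \<open>L\<close>, because \<open>v\<^sub>k \<rightarrow> 0\<close> and \<open>\<Sum>v\<^sub>k = \<infinity>\<close>. It is applied
  to \<open>\<parallel>x\<^sub>k - z\<parallel>\<^sup>2\<close> for a fixed minimizer \<open>z\<close> (boundedness, by coercivity), to
  \<open>dist\<^sup>2(x\<^sub>k, X\<^sup>*) / v\<^sub>k\<close> when \<open>\<epsilon> = 0\<close>, and to \<open>dist\<^sup>2(x\<^sub>k, X\<^sup>*)\<close> when \<open>\<epsilon> > 0\<close>. In the last case the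
  distance is eventually below its threshold, and the geometric term only has to absorb the finitely
  many earlier iterates.
\<close>

section \<open>Trapping of real sequences by a drift with divergent total\<close>

lemma eventually_le_of_drift:
  fixes u w :: "nat \<Rightarrow> real"
  assumes w0: "w \<longlonglongrightarrow> 0" and div: "\<not> summable w"
    and pos: "\<forall>\<^sub>F k in sequentially. 0 \<le> w k"
    and "L < K" and "0 < \<delta>"
    and drop: "\<forall>\<^sub>F k in sequentially. L < u k \<longrightarrow> u (Suc k) \<le> u k - \<delta> * w k"
    and grow: "\<forall>\<^sub>F k in sequentially. u (Suc k) \<le> u k + M * w k"
  shows "\<forall>\<^sub>F k in sequentially. u k \<le> K"
proof -
  have "(\<lambda>k. M * w k) \<longlonglongrightarrow> M * 0"
    by (intro tendsto_intros w0)
  then have "\<forall>\<^sub>F k in sequentially. M * w k < K - L"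
    using \<open>L < K\<close> by (intro order_tendstoD(2)) auto
  with pos drop grow
  have "\<forall>\<^sub>F k in sequentially. 0 \<le> w k \<and> (L < u k \<longrightarrow> u (Suc k) \<le> u k - \<delta> * w k) \<and>
          u (Suc k) \<le> u k + M * w k \<and> M * w k < K - L"
    by eventually_elim auto
  then obtain N where N: "\<And>k. k \<ge> N \<Longrightarrow> 0 \<le> w k"
      "\<And>k. k \<ge> N \<Longrightarrow> L < u k \<Longrightarrow> u (Suc k) \<le> u k - \<delta> * w k"
      "\<And>k. k \<ge> N \<Longrightarrow> u (Suc k) \<le> u k + M * w k"
      "\<And>k. k \<ge> N \<Longrightarrow> M * w k < K - L"
    unfolding eventually_sequentially by blast
  \<comment> \<open>If \<open>u\<close> stayed above \<open>L\<close>, telescoping the drops would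
    bound the partial sums of \<open>w\<close>, contradicting \<open>div\<close>.\<close>
  have "\<exists>m\<ge>N. u m \<le> L"
  proof (rule ccontr)
    assume "\<not> ?thesis"
    then have above: "L < u k" if "k \<ge> N" for k
      using that by force
    have sum_le: "\<delta> * (\<Sum>j<n. w (j + N)) \<le> u N - u (n + N)" for n
    proof (induction n)
      case (Suc n)
      then show ?case
        using N(2)[of "n + N"] above[of "n + N"] by (simp add: algebra_simps)
    qed simp
    have "(\<Sum>j<n. w (j + N)) \<le> (u N - L) / \<delta>" for n
      using sum_le[of n] above[of "n + N"] \<open>0 < \<delta>\<close> by (simp add: field_simps)
    then have "summable (\<lambda>j. w (j + N))"
      by (intro bounded_imp_summable[where B = "(u N - L) / \<delta>"])
        (use N(1) in \<open>auto simp del: sum.lessThan_Suc simp flip: lessThan_Suc_atMost\<close>)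
    with div show False
      by (simp add: summable_iff_shift)
  qed
  then obtain m where m: "m \<ge> N" "u m \<le> L"
    by blast
  \<comment> \<open>The level \<open>K\<close> is never crossed again: from at most \<open>L\<close>
    a step gains less than \<open>K - L\<close>, and between \<open>L\<close> and \<open>K\<close>
    the sequence cannot increase.\<close>
  have "u k \<le> K" if "k \<ge> m" for k
    using that
  proof (induction k rule: dec_induct)
    case base
    then show ?case using m(2) \<open>L < K\<close> by simp
  next
    case (step k)
    have k: "k \<ge> N" using step m by simp
    show ?case
    proof (cases "L < u k")
      case True
      have "0 \<le> \<delta> * w k" using N(1)[OF k] \<open>0 < \<delta>\<close> by simp
      with N(2)[OF k True] step.IH show ?thesis by linarith
    next
      case False
      then show ?thesis using N(3)[OF k] N(4)[OF k] by linarith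
    qed
  qed
  then show ?thesis
    unfolding eventually_sequentially by blast
qed

text \<open>Closedness is what lets a nearest minimizer exist, so that the basic inequality can be
  used at it.\<close>

lemma closed_minimizers:
  fixes f :: "'a::topological_space \<Rightarrow> real"
  assumes "continuous_on UNIV f" and "closed X"
  shows "closed (minimizers f X)"
proof (cases "minimizers f X = {}")
  case False
  then obtain z where z: "z \<in> minimizers f X" by blast
  then have "minimizers f X = X \<inter> {y. f y \<le> f z}"
    by (fastforce simp: minimizers_def is_arg_min_def not_less)
  with assms show ?thesis
    by (auto intro!: closed_Int closed_Collect_le continuous_on_const)
qed simp

text \<open>Since \<open>b k * w k\<close> tends to 0, the quadratic error of the recursion cannot
  offset a linear drop.\<close>

lemma eventually_mult_square_le:
  fixes w b :: "nat \<Rightarrow> real"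
  assumes "w \<longlonglongrightarrow> 0" and "\<forall>\<^sub>F k in sequentially. 0 \<le> w k" and "b \<longlonglongrightarrow> b'" and "0 < \<delta>"
  shows "\<forall>\<^sub>F k in sequentially. b k * (w k)\<^sup>2 \<le> \<delta> * w k"
proof -
  have "(\<lambda>k. b k * w k) \<longlonglongrightarrow> b' * 0"
    by (intro tendsto_intros assms)
  then have "\<forall>\<^sub>F k in sequentially. b k * w k < \<delta>"
    using \<open>0 < \<delta>\<close> by (intro order_tendstoD(2)) auto
  with assms(2) show ?thesis
  proof eventually_elim
    case (elim k)
    then have "(b k * w k) * w k \<le> \<delta> * w k"
      by (intro mult_right_mono) auto
    then show ?case by (simp add: power2_eq_square mult.assoc)
  qed
qed

text \<open>Eventually \<open>a k > a' / 2\<close>, so the \<open>g\<close> term yields a drop of at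
  least \<open>a' * m / 2 * w k\<close>; half of it pays for the quadratic error. \<open>P\<close>
  singles out the indices where \<open>g\<close> is bounded below.\<close>

lemma eventually_drop:
  fixes a b w g :: "nat \<Rightarrow> real"
  assumes "w \<longlonglongrightarrow> 0" and "\<forall>\<^sub>F k in sequentially. 0 \<le> w k"
    and "a \<longlonglongrightarrow> a'" and "0 < a'" and "b \<longlonglongrightarrow> b'" and "0 < m"
    and "\<And>k. P k \<Longrightarrow> m \<le> g k"
    and "\<forall>\<^sub>F k in sequentially. u (Suc k) \<le> u k - a k * w k * g k + b k * (w k)\<^sup>2"
  shows "\<forall>\<^sub>F k in sequentially. P k \<longrightarrow> u (Suc k) \<le> u k - a' * m / 4 * w k"
proof -
  have "\<forall>\<^sub>F k in sequentially. a' / 2 < a k"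
    using assms by (intro order_tendstoD(1)) auto
  moreover have "\<forall>\<^sub>F k in sequentially. b k * (w k)\<^sup>2 \<le> a' * m / 4 * w k"
    using assms by (intro eventually_mult_square_le[where b' = b']) auto
  ultimately show ?thesis
    using assms(2,8)
  proof eventually_elim
    case (elim k)
    show ?case
    proof
      assume "P k"
      have "(a' / 2 * w k) * m \<le> (a k * w k) * g k"
        using elim assms(4,6) assms(7)[OF \<open>P k\<close>] by (intro mult_mono) (auto intro: mult_right_mono)
      with elim show "u (Suc k) \<le> u k - a' * m / 4 * w k"
        by (simp add: algebra_simps)
    qed
  qed
qed

section \<open>Asymptotics of the step sizes and of recursions driven by them\<close>

lemma powr_neg_ratio_le:
  assumes "k \<ge> 1" and "s \<le> 1"
  shows "real k powr (- s) \<le> (1 + 1 / real k) * real (Suc k) powr (- s)"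
proof -
  have "(real (Suc k) / real k) powr s \<le> (real (Suc k) / real k) powr 1"
    using assms by (intro powr_mono) auto
  also have "\<dots> = 1 + 1 / real k"
    using assms by (simp add: field_simps)
  finally have "real (Suc k) powr s / real k powr s \<le> 1 + 1 / real k"
    by (simp add: powr_divide)
  then show ?thesis
    using assms by (simp add: powr_minus field_simps del: of_nat_Suc)
qed

lemma step_size_tendsto_0:
  fixes v :: "nat \<Rightarrow> real"
  assumes "0 < s" and "\<And>k. k \<ge> 1 \<Longrightarrow> v k = c * real k powr (- s)"
  shows "v \<longlonglongrightarrow> 0"
proof -
  have "(\<lambda>k. c * real k powr (- s)) \<longlonglongrightarrow> c * 0"
    using assms(1) by (intro tendsto_intros tendsto_neg_powr filterlim_real_sequentially) auto
  moreover have "\<forall>\<^sub>F k in sequentially. v k = c * real k powr (- s)"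
    using assms(2) by (intro eventually_sequentiallyI[of 1]) auto
  ultimately show ?thesis
    by (simp add: tendsto_cong)
qed

lemma step_size_not_summable:
  fixes v :: "nat \<Rightarrow> real"
  assumes "s < 1" and "0 < c" and "\<And>k. k \<ge> 1 \<Longrightarrow> v k = c * real k powr (- s)"
  shows "\<not> summable v"
proof -
  have "\<forall>\<^sub>F k in sequentially. v k = c * real k powr (- s)"
    using assms(3) by (intro eventually_sequentiallyI[of 1]) auto
  then have "summable v \<longleftrightarrow> summable (\<lambda>k. c * real k powr (- s))"
    by (rule summable_cong)
  also have "\<dots> \<longleftrightarrow> summable (\<lambda>k. real k powr (- s))"
    using assms(2) by (simp add: summable_cmult_iff)
  finally show ?thesis
    using assms(1) by (simp add: summable_real_powr_iff)
qed

text \<open>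
  A form of Chung's lemma: dividing by \<open>v\<^sub>k\<close> perturbs the recursion by the factor
  \<open>v\<^sub>k / v\<^bsub>k+1\<^esub> \<le> 1 + 1/k\<close>, which is harmless because \<open>1/k = o(v\<^sub>k)\<close> for \<open>s < 1\<close>.
\<close>

lemma eventually_le_step_size:
  fixes D v a b :: "nat \<Rightarrow> real"
  assumes s: "0 < s" "s < 1" and c: "0 < c"
    and v: "\<And>k. k \<ge> 1 \<Longrightarrow> v k = c * real k powr (- s)"
    and D: "\<And>k. 0 \<le> D k"
    and a: "a \<longlonglongrightarrow> A" "0 < A" and b: "b \<longlonglongrightarrow> B" "0 < B"
    and rec: "\<forall>\<^sub>F k in sequentially. D (Suc k) \<le> D k - a k * v k * D k + b k * (v k)\<^sup>2"
  shows "\<forall>\<^sub>F k in sequentially. D k \<le> 2 * B / A * v k"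
proof -
  have ev1: "\<forall>\<^sub>F k in sequentially. (1::nat) \<le> k"
    by (rule eventually_ge_at_top)
  define U where "U k = D k / v k" for k
  \<comment> \<open>For \<open>k \<ge> 1\<close> this is \<open>(1 / real k) / v k\<close>, the
    amount by which the factor \<open>1 + 1 / real k\<close> weakens the contraction in
    \<open>a1\<close>.\<close>
  define h where "h k = real k powr (s - 1) / c" for k
  define a1 where "a1 k = (1 + 1 / real k) * a k - h k" for k
  define b1 where "b1 k = (1 + 1 / real k) * b k" for k
  have vpos: "0 < v k" if "k \<ge> 1" for k
    using v[OF that] c that by simp
  have rho: "(\<lambda>k. 1 + 1 / real k) \<longlonglongrightarrow> 1 + 0"
    by (intro tendsto_intros lim_1_over_n)
  have h0: "h \<longlonglongrightarrow> 0 / c"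
    unfolding h_def using s c
    by (intro tendsto_intros tendsto_neg_powr filterlim_real_sequentially) auto
  have "a1 \<longlonglongrightarrow> (1 + 0) * A - 0 / c"
    unfolding a1_def by (intro tendsto_intros rho h0 a)
  then have a1: "\<forall>\<^sub>F k in sequentially. 4 / 5 * A < a1 k"
    using a by (intro order_tendstoD(1)) auto
  have "b1 \<longlonglongrightarrow> (1 + 0) * B"
    unfolding b1_def by (intro tendsto_intros rho b)
  then have b1: "\<forall>\<^sub>F k in sequentially. b1 k < 6 / 5 * B"
    using b by (intro order_tendstoD(2)) auto
  have step: "\<forall>\<^sub>F k in sequentially. U (Suc k) \<le> U k - v k * (a1 k * U k - b1 k)"
    using ev1 rec
  proof eventually_elim
    case (elim k)
    let ?r = "1 + 1 / real k"
    have vk: "v k > 0" "v (Suc k) > 0" using vpos elim(1) by auto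
    have "v k \<le> ?r * v (Suc k)"
      using powr_neg_ratio_le[OF elim(1), of s] s c v[OF elim(1)] v[of "Suc k"]
      by (simp add: mult.left_commute del: of_nat_Suc)
    then have "v k * D (Suc k) \<le> (?r * v (Suc k)) * D (Suc k)"
      using D by (intro mult_right_mono) auto
    then have "U (Suc k) \<le> ?r * (D (Suc k) / v k)"
      unfolding U_def using vk by (simp add: field_simps)
    also have "\<dots> \<le> ?r * ((D k - a k * v k * D k + b k * (v k)\<^sup>2) / v k)"
      using elim(2) vk by (intro mult_left_mono divide_right_mono) auto
    also have "(D k - a k * v k * D k + b k * (v k)\<^sup>2) / v k = U k - a k * v k * U k + b k * v k"
      unfolding U_def using vk by (simp add: field_simps power2_eq_square)
    also have "?r * (U k - a k * v k * U k + b k * v k) =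
        U k - v k * (((?r * a k) - (1 / real k) / v k) * U k - ?r * b k)"
      using vk by (simp add: field_simps)
    also have "(1 / real k) / v k = h k"
      using elim(1) c unfolding v[OF elim(1)] h_def by (simp add: powr_diff powr_minus field_simps)
    finally show ?case
      by (simp add: a1_def b1_def)
  qed
  have "\<forall>\<^sub>F k in sequentially. U k \<le> 2 * B / A"
  proof (rule eventually_le_of_drift)
    show "v \<longlonglongrightarrow> 0" "\<not> summable v"
      using step_size_tendsto_0[OF s(1) v] step_size_not_summable[OF s(2) c v] by auto
    show "\<forall>\<^sub>F k in sequentially. 0 \<le> v k"
      using ev1 by eventually_elim (use vpos less_imp_le in blast)
    \<comment> \<open>In the limit the drift vanishes at \<open>B / A\<close>, so the target
      \<open>2 * B / A\<close> leaves room for the level \<open>7 / 4 * B / A\<close>. With the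
      margins \<open>4 / 5\<close> and \<open>6 / 5\<close>, the drift above that level is at least
      \<open>7 / 5 * B - 6 / 5 * B = B / 5\<close>.\<close>
    show "7 / 4 * B / A < 2 * B / A" "0 < B / 5"
      using a b by (auto simp: field_simps)
    show "\<forall>\<^sub>F k in sequentially. 7 / 4 * B / A < U k \<longrightarrow> U (Suc k) \<le> U k - B / 5 * v k"
      using step a1 b1 ev1
    proof eventually_elim
      case (elim k)
      show ?case
      proof
        assume U: "7 / 4 * B / A < U k"
        have "(4 / 5 * A) * (7 / 4 * B / A) \<le> a1 k * U k"
          using U elim a b by (intro mult_mono) auto
        then have "B / 5 \<le> a1 k * U k - b1 k"
          using elim a by simp
        then have "B / 5 * v k \<le> (a1 k * U k - b1 k) * v k"
          using vpos[OF elim(4)] by (intro mult_right_mono) auto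
        with elim(1) show "U (Suc k) \<le> U k - B / 5 * v k"
          by (simp add: mult.commute)
      qed
    qed
    show "\<forall>\<^sub>F k in sequentially. U (Suc k) \<le> U k + 6 / 5 * B * v k"
      using step a1 b1 ev1
    proof eventually_elim
      case (elim k)
      have "0 \<le> a1 k * U k"
        using elim a vpos[OF elim(4)] D[of k] by (simp add: U_def)
      then have "(b1 k - a1 k * U k) * v k \<le> 6 / 5 * B * v k"
        using elim vpos[OF elim(4)] by (intro mult_right_mono) auto
      with elim(1) show ?case
        by (simp add: algebra_simps)
    qed
  qed
  with ev1 show ?thesis
    by eventually_elim (use vpos in \<open>simp add: U_def pos_divide_le_eq\<close>)
qed

theorem theorem3p5:
  fixes f :: "real ^ 'n \<Rightarrow> real"
    and X :: "(real ^ 'n) set"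
    and x :: "nat \<Rightarrow> real ^ 'n"
    and v \<alpha> \<beta> \<gamma> :: "nat \<Rightarrow> real"
    and \<alpha>' \<beta>' \<gamma>' \<epsilon> p c s :: real
    and \<eta> :: "real \<Rightarrow> real"
  assumes "quasi_convex f" and "continuous_on UNIV f" and "filterlim f at_top at_infinity"
    and "X \<noteq> {}" and "closed X" and "convex X"
    and "minimizers f X \<noteq> {}"
    and "\<epsilon> \<ge> 0" and "0 < p" and "p \<le> 1"
    and "c > 0" and "0 < s" and "s < 1"
    and "\<And>k. k \<ge> 1 \<Longrightarrow> v k = c * real k powr (- s)"
    and "\<And>k. k \<ge> 1 \<Longrightarrow> x k \<in> X"
    and "\<And>k. k \<ge> 1 \<Longrightarrow> \<alpha> k > 0" and "\<And>k. k \<ge> 1 \<Longrightarrow> \<beta> k > 0" and "\<And>k. k \<ge> 1 \<Longrightarrow> \<gamma> k > 0"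
    and "\<alpha> \<longlonglongrightarrow> \<alpha>'" and "\<alpha>' > 0"
    and "\<beta> \<longlonglongrightarrow> \<beta>'" and "\<beta>' > 0"
    and "\<gamma> \<longlonglongrightarrow> \<gamma>'" and "\<gamma>' > 0"
    and "\<And>z k. z \<in> minimizers f X \<Longrightarrow> k \<ge> 1 \<Longrightarrow> f (x k) > opt_value f X + \<epsilon> \<Longrightarrow>
           (norm (x (k + 1) - z))\<^sup>2 - (norm (x k - z))\<^sup>2
             \<le> - \<alpha> k * v k * (f (x k) - opt_value f X - \<epsilon>) powr (1 / p) + \<beta> k * (v k)\<^sup>2"
    and "\<And>k. k \<ge> 1 \<Longrightarrow> norm (x (k + 1) - x k) \<le> \<gamma> k * v k"
    and "boundedly_weak_sharp_minima f X (2 * p)"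
    and "\<And>r. r > 0 \<Longrightarrow> minimizers f X \<inter> cball 0 r \<noteq> {} \<Longrightarrow>
           \<eta> r > 0 \<and> weak_sharp_minima f (cball 0 r) X (2 * p) (\<eta> r)"
  shows "(\<exists>k\<ge>1. x k \<in> eps_minimizers f X \<epsilon>) \<or>
    (\<exists>r>0. minimizers f X \<inter> cball 0 r \<noteq> {} \<and> (\<forall>k\<ge>1. x k \<in> cball 0 r) \<and>
       (\<epsilon> = 0 \<longrightarrow>
          (\<exists>N\<ge>1. \<forall>k\<ge>N. (infdist (x k) (minimizers f X))\<^sup>2
             \<le> \<beta>' * c / \<alpha>' * (2 / \<eta> r) powr (1 / p) * real k powr (- s))) \<and>
       (\<epsilon> > 0 \<longrightarrow>
          (\<exists>C>0. \<exists>\<tau>. 0 < \<tau> \<and> \<tau> < 1 \<and>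
             (\<forall>k\<ge>1. (infdist (x k) (minimizers f X))\<^sup>2
                \<le> C * \<tau> ^ k + (2 * \<epsilon> / \<eta> r) powr (1 / p)))))"
proof (cases "\<exists>k\<ge>1. x k \<in> eps_minimizers f X \<epsilon>")
  case False
  note coercive = assms(3) and eps = assms(8) and p = assms(9,10) and c = assms(11)
    and s = assms(12,13) and v = assms(14) and xX = assms(15)
    and al = assms(19,20) and be = assms(21,22)
    and basic = assms(25) and sharp = assms(28)
  let ?Z = "minimizers f X"
  let ?fs = "opt_value f X"
  define G where "G k = (f (x k) - ?fs - \<epsilon>) powr (1 / p)" for k
  define D where "D k = (infdist (x k) ?Z)\<^sup>2" for k
  have above: "?fs + \<epsilon> < f (x k)" if "k \<ge> 1" for k
    using False xX[OF that] that by (force simp: eps_minimizers_def)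
  have rec: "(norm (x (Suc k) - z))\<^sup>2 \<le> (norm (x k - z))\<^sup>2 - \<alpha> k * v k * G k + \<beta> k * (v k)\<^sup>2"
    if "k \<ge> 1" "z \<in> ?Z" for k z
    using basic[OF that(2,1) above[OF that(1)]] by (simp add: G_def)
  have ev1: "\<forall>\<^sub>F k in sequentially. (1::nat) \<le> k"
    by (rule eventually_ge_at_top)
  have v0: "v \<longlonglongrightarrow> 0" and vdiv: "\<not> summable v"
    using step_size_tendsto_0[OF s(1) v] step_size_not_summable[OF s(2) c v] by auto
  have vpos: "0 < v k" if "k \<ge> 1" for k
    using v[OF that] c that by simp
  have vnn: "\<forall>\<^sub>F k in sequentially. 0 \<le> v k"
    using ev1 by eventually_elim (use vpos less_imp_le in blast)
  \<comment> \<open>Shared by the boundedness argument and the case \<open>\<epsilon> > 0\<close>.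
    The guard \<open>k \<ge> 1\<close> is there because the hypotheses say nothing about index
    0.\<close>
  have trap: "\<forall>\<^sub>F k in sequentially. u k \<le> K"
    if "L < K" "0 < m" "\<And>k. k \<ge> 1 \<and> L < u k \<Longrightarrow> m \<le> G k"
      "\<forall>\<^sub>F k in sequentially. u (Suc k) \<le> u k - \<alpha> k * v k * G k + \<beta> k * (v k)\<^sup>2"
    for u :: "nat \<Rightarrow> real" and L K m
  proof (rule eventually_le_of_drift[OF v0 vdiv vnn \<open>L < K\<close>])
    show "0 < \<alpha>' * m / 4"
      using al that by simp
    have "\<forall>\<^sub>F k in sequentially. k \<ge> 1 \<and> L < u k \<longrightarrow> u (Suc k) \<le> u k - \<alpha>' * m / 4 * v k"
      by (rule eventually_drop[OF v0 vnn al be(1) that(2-4)])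
    with ev1 show "\<forall>\<^sub>F k in sequentially. L < u k \<longrightarrow> u (Suc k) \<le> u k - \<alpha>' * m / 4 * v k"
      by eventually_elim simp
    \<comment> \<open>The \<open>G\<close> term is nonnegative, so only the quadratic error can
      cause growth, and it is eventually at most \<open>v k\<close>.\<close>
    show "\<forall>\<^sub>F k in sequentially. u (Suc k) \<le> u k + 1 * v k"
      using that(4) eventually_mult_square_le[OF v0 vnn be(1), of 1, simplified] ev1
    proof eventually_elim
      case (elim k)
      have "0 \<le> \<alpha> k * v k * G k"
        using assms(16)[OF elim(3)] vpos[OF elim(3)] by (simp add: G_def)
      with elim show ?case by simp
    qed
  qed

  \<comment> \<open>Boundedness of the iterates and choice of the radius\<close>
  obtain z where z: "z \<in> ?Z"
    using assms(7) by blast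
  have "\<forall>\<^sub>F y in at_infinity. ?fs + \<epsilon> + 1 \<le> f y"
    using coercive by (simp add: filterlim_at_top)
  then obtain R where R: "\<And>y. R \<le> norm y \<Longrightarrow> ?fs + \<epsilon> + 1 \<le> f y"
    unfolding eventually_at_infinity by blast
  \<comment> \<open>A squared distance to \<open>z\<close> above \<open>L\<close> forces
    \<open>norm (x k) > \<bar>R\<bar>\<close>, where coercivity gives
    \<open>G k \<ge> 1\<close>.\<close>
  define L where "L = (\<bar>R\<bar> + norm z)\<^sup>2"
  have "\<forall>\<^sub>F k in sequentially. (norm (x k - z))\<^sup>2 \<le> L + 1"
  proof (rule trap[where m = 1])
    fix k assume k: "k \<ge> 1 \<and> L < (norm (x k - z))\<^sup>2"
    then have "\<bar>R\<bar> + norm z < norm (x k - z)"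
      unfolding L_def by (intro power2_less_imp_less[of "\<bar>R\<bar> + norm z"]) auto
    also have "\<dots> \<le> norm (x k) + norm z"
      by (rule norm_triangle_ineq4)
    finally have "1 \<le> f (x k) - ?fs - \<epsilon>"
      using R[of "x k"] by linarith
    then show "1 \<le> G k"
      unfolding G_def using p by (intro ge_one_powr_ge_zero) auto
  next
    show "\<forall>\<^sub>F k in sequentially. (norm (x (Suc k) - z))\<^sup>2
        \<le> (norm (x k - z))\<^sup>2 - \<alpha> k * v k * G k + \<beta> k * (v k)\<^sup>2"
      using ev1 by eventually_elim (use rec z in blast)
  qed auto
  then obtain N where N: "\<And>k. k \<ge> N \<Longrightarrow> (norm (x k - z))\<^sup>2 \<le> L + 1"
    unfolding eventually_sequentially by blast
  have "x k \<in> x ` {..N} \<union> cball z (sqrt (L + 1))" for k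
    using N[of k] by (cases "k \<le> N") (auto simp: dist_norm norm_minus_commute real_le_rsqrt)
  then have "range x \<subseteq> x ` {..N} \<union> cball z (sqrt (L + 1))"
    by blast
  \<comment> \<open>Including \<open>z\<close> makes the ball of radius \<open>r\<close> meet the
    minimizers, as the modulus \<open>\<eta> r\<close> requires.\<close>
  then have "bounded (insert z (range x))"
    by (meson bounded_Un bounded_cball bounded_insert bounded_subset finite_atMost finite_imageI
        finite_imp_bounded)
  then obtain r where r: "0 < r" "\<And>y. y \<in> insert z (range x) \<Longrightarrow> norm y \<le> r"
    unfolding bounded_pos by blast
  have Zr: "?Z \<inter> cball 0 r \<noteq> {}"
    using z r(2)[of z] by auto
  have \<eta>: "0 < \<eta> r" and ws: "weak_sharp_minima f (cball 0 r) X (2 * p) (\<eta> r)"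
    using sharp[OF r(1) Zr] by auto
  \<comment> \<open>As \<open>D\<close> is the squared distance, order \<open>2 * p\<close> turns
    into the power \<open>p\<close>.\<close>
  have growth: "\<eta> r * D k powr p \<le> f (x k) - ?fs" if "k \<ge> 1" for k
  proof -
    have "D k powr p = infdist (x k) ?Z powr (2 * p)"
      unfolding D_def by (simp add: powr_powr infdist_nonneg flip: powr_numeral)
    then show ?thesis
      using ws xX[OF that] r(2)[of "x k"] unfolding weak_sharp_minima_def by auto
  qed
  have recD: "\<forall>\<^sub>F k in sequentially. D (Suc k) \<le> D k - \<alpha> k * v k * G k + \<beta> k * (v k)\<^sup>2"
    using ev1
  proof eventually_elim
    case (elim k)
    \<comment> \<open>The basic inequality is used at the minimizer nearest to \<open>x k\<close>;
      the distance to this same point bounds the next distance to the set.\<close>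
    obtain y where y: "y \<in> ?Z" "infdist (x k) ?Z = dist (x k) y"
      using infdist_attains_inf[OF closed_minimizers[OF assms(2,5)] assms(7)] by blast
    have "D (Suc k) \<le> (norm (x (Suc k) - y))\<^sup>2"
      unfolding D_def using infdist_le[OF y(1), of "x (Suc k)"]
      by (intro power_mono) (auto simp: dist_norm infdist_nonneg)
    with rec[OF elim y(1)] show ?case
      by (simp add: D_def y(2) dist_norm)
  qed
  have Dnn: "0 \<le> D k" for k
    by (simp add: D_def)

  \<comment> \<open>The rate for vanishing \<epsilon>\<close>
  have i: "\<exists>N\<ge>1. \<forall>k\<ge>N. D k \<le> \<beta>' * c / \<alpha>' * (2 / \<eta> r) powr (1 / p) * real k powr (- s)"
    if "\<epsilon> = 0"
  proof -
    \<comment> \<open>Raising \<open>growth\<close> to the power \<open>1 / p\<close> makes it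
      linear in \<open>D\<close>, which puts the recursion in the form of
      \<open>eventually_le_step_size\<close>.\<close>
    define E where "E = \<eta> r powr (1 / p)"
    have E: "0 < E" using \<eta> by (simp add: E_def)
    have GD: "E * D k \<le> G k" if "k \<ge> 1" for k
    proof -
      have "E * D k = (\<eta> r * D k powr p) powr (1 / p)"
        using \<eta> Dnn p by (simp add: E_def powr_mult powr_powr)
      also have "\<dots> \<le> G k"
        unfolding G_def using growth[OF that] \<open>\<epsilon> = 0\<close> \<eta> p by (intro powr_mono2) auto
      finally show ?thesis .
    qed
    have "\<forall>\<^sub>F k in sequentially. D (Suc k) \<le> D k - (\<alpha> k * E) * v k * D k + \<beta> k * (v k)\<^sup>2"
      using recD ev1
    proof eventually_elim
      case (elim k)
      have "\<alpha> k * v k * (E * D k) \<le> \<alpha> k * v k * G k"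
        using GD[OF elim(2)] assms(16)[OF elim(2)] vpos[OF elim(2)] by (intro mult_left_mono) auto
      with elim(1) show ?case by (simp add: mult_ac)
    qed
    moreover have "(\<lambda>k. \<alpha> k * E) \<longlonglongrightarrow> \<alpha>' * E"
      by (intro tendsto_intros al)
    ultimately have "\<forall>\<^sub>F k in sequentially. D k \<le> 2 * \<beta>' / (\<alpha>' * E) * v k"
      using al E be by (intro eventually_le_step_size[OF s c v Dnn]) auto
    then obtain N where N: "\<And>k. k \<ge> N \<Longrightarrow> D k \<le> 2 * \<beta>' / (\<alpha>' * E) * v k"
      unfolding eventually_sequentially by blast
    \<comment> \<open>The rate obtained so far has the factor 2; since \<open>p \<le> 1\<close>, it
      may be enlarged to \<open>2 powr (1 / p)\<close> and merged with \<open>E\<close> into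
      \<open>(2 / \<eta> r) powr (1 / p)\<close>.\<close>
    have "(2::real) powr 1 \<le> 2 powr (1 / p)"
      using p by (intro powr_mono) auto
    then have "2 * \<beta>' / (\<alpha>' * E) \<le> 2 powr (1 / p) * \<beta>' / (\<alpha>' * E)"
      using al be E by (intro divide_right_mono mult_right_mono) auto
    also have "\<dots> = \<beta>' / \<alpha>' * (2 / \<eta> r) powr (1 / p)"
      using \<eta> by (simp add: E_def powr_divide)
    finally have le: "2 * \<beta>' / (\<alpha>' * E) \<le> \<beta>' / \<alpha>' * (2 / \<eta> r) powr (1 / p)" .
    have "D k \<le> \<beta>' * c / \<alpha>' * (2 / \<eta> r) powr (1 / p) * real k powr (- s)" if "k \<ge> max N 1" for k
    proof -
      have k: "k \<ge> N" "k \<ge> 1" using that by auto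
      have "D k \<le> 2 * \<beta>' / (\<alpha>' * E) * v k" by (rule N[OF k(1)])
      also have "\<dots> \<le> (\<beta>' / \<alpha>' * (2 / \<eta> r) powr (1 / p)) * v k"
        using le vpos[OF k(2)] by (intro mult_right_mono) auto
      finally show ?thesis
        unfolding v[OF k(2)] by (simp add: mult_ac)
    qed
    then show ?thesis
      by (intro exI[of _ "max N 1"]) auto
  qed

  \<comment> \<open>The geometric bound for positive \<epsilon>\<close>
  have ii: "\<exists>C>0. \<exists>\<tau>. 0 < \<tau> \<and> \<tau> < 1 \<and>
      (\<forall>k\<ge>1. D k \<le> C * \<tau> ^ k + (2 * \<epsilon> / \<eta> r) powr (1 / p))" if "\<epsilon> > 0"
  proof -
    define T where "T = (2 * \<epsilon> / \<eta> r) powr (1 / p)"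
    \<comment> \<open>The factor \<open>3 / 2\<close> lies strictly between 1 and 2: the level stays
      below \<open>T\<close>, while above it the gap to the minimum value exceeds \<epsilon> by at
      least \<open>\<epsilon> / 2\<close>.\<close>
    define L where "L = (3 / 2 * \<epsilon> / \<eta> r) powr (1 / p)"
    have "\<forall>\<^sub>F k in sequentially. D k \<le> T"
    proof (rule trap[OF _ _ _ recD])
      have "3 / 2 * \<epsilon> / \<eta> r < 2 * \<epsilon> / \<eta> r"
        using \<open>\<epsilon> > 0\<close> \<eta> by (intro divide_strict_right_mono) auto
      then show "L < T"
        unfolding L_def T_def using \<open>\<epsilon> > 0\<close> \<eta> p by (intro powr_less_mono2) auto
      show "0 < (\<epsilon> / 2) powr (1 / p)"
        using \<open>\<epsilon> > 0\<close> by simp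
      fix k assume k: "k \<ge> 1 \<and> L < D k"
      have "L powr p \<le> D k powr p"
        using k p by (intro powr_mono2) (auto simp: L_def)
      moreover have "L powr p = 3 / 2 * \<epsilon> / \<eta> r"
        using p \<open>\<epsilon> > 0\<close> \<eta> by (simp add: L_def powr_powr)
      ultimately have "3 / 2 * \<epsilon> \<le> \<eta> r * D k powr p"
        using \<eta> by (simp add: field_simps)
      then have "\<epsilon> / 2 \<le> f (x k) - ?fs - \<epsilon>"
        using growth k by fastforce
      then show "(\<epsilon> / 2) powr (1 / p) \<le> G k"
        unfolding G_def using p \<open>\<epsilon> > 0\<close> by (intro powr_mono2) auto
    qed
    then obtain N where N: "\<And>k. k \<ge> N \<Longrightarrow> D k \<le> T"
      unfolding eventually_sequentially by blast
    \<comment> \<open>The weights \<open>2 ^ j\<close> cancel the ratio \<open>1 / 2\<close> at the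
      finitely many early indices; the summand 1 keeps \<open>C\<close> positive even if the sum is
      0.\<close>
    define C where "C = 1 + (\<Sum>j<N. D j * 2 ^ j)"
    have C: "0 < C"
      unfolding C_def using Dnn by (intro add_pos_nonneg sum_nonneg) auto
    have "D k \<le> C * (1 / 2) ^ k + T" for k
    proof (cases "k < N")
      case True
      have "D k * 2 ^ k \<le> (\<Sum>j<N. D j * 2 ^ j)"
        using True Dnn by (intro member_le_sum) auto
      then have "D k \<le> C * (1 / 2) ^ k"
        unfolding C_def by (simp add: field_simps power_divide)
      moreover have "0 \<le> T" by (simp add: T_def)
      ultimately show ?thesis by simp
    next
      case False
      then have "D k \<le> T" using N by simp
      moreover have "0 \<le> C * (1 / 2) ^ k" using C by simp
      ultimately show ?thesis by linarith
    qed
    then show ?thesis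
      using C unfolding T_def by (intro exI[of _ C] conjI exI[of _ "1 / 2"]) auto
  qed
  show ?thesis
    using r Zr i ii unfolding D_def by (intro disjI2 exI[of _ r] conjI) auto
qed blast

end
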